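(* If $G$ is an $n$-connector, then $G$ is $(k,n-k)$-ST-robust for all $1\le k\le n$.
   Context: A DAG $G$ with $n$ inputs and $n$ outputs is an $n$-connector if for every $1\le r\le n$, every ordered list $x_1,\dots,x_r$ of distinct inputs and every ordered list $y_1,\dots,y_r$ of distinct outputs, there are $r$ vertex-disjoint paths in $G$ connecting $x_i$ to $y_i$ for each $i\le r$. For a DAG $G=(V,E)$ with a set $I$ of $n$ inputs and a set $O$ of $n$ outputs, $G$ is $(k_1,k_2)$-ST-robust if for every $D\subseteq V$ with $|D|\le k_1$ there is a subgraph $H$ of $G-D$ with $|I\cap V(H)|\ge k_2$ and $|O\cap V(H)|\ge k_2$ such that for every $s\in I\cap V(H)$ and every $t\in O\cap V(H)$ there is a directed path from $s$ to $t$ in $H$. *)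

theory Defs
  imports "Graph_Theory.Graph_Theory"
begin

definition dag :: "('a, 'b) pre_digraph \<Rightarrow> bool" where
  "dag G \<longleftrightarrow> digraph G \<and> \<not> (\<exists>c. pre_digraph.cycle G c)"

text \<open>
  Inputs and outputs are designated sets of vertices; they are not required to be sources or
  sinks of the graph, nor to be disjoint.
\<close>

definition io_dag :: "nat \<Rightarrow> ('a, 'b) pre_digraph \<Rightarrow> 'a set \<Rightarrow> 'a set \<Rightarrow> bool" where
  "io_dag n G ins outs \<longleftrightarrow>
     dag G \<and> ins \<subseteq> verts G \<and> outs \<subseteq> verts G \<and> card ins = n \<and> card outs = n"

text \<open>
  Vertex-disjointness concerns all vertices of the paths, endpoints included. A path may
  have length zero.
\<close>

definition connector :: "nat \<Rightarrow> ('a, 'b) pre_digraph \<Rightarrow> 'a set \<Rightarrow> 'a set \<Rightarrow> bool" where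
  "connector n G ins outs \<longleftrightarrow>
     io_dag n G ins outs \<and>
     (\<forall>r xs ys.
        1 \<le> r \<and> r \<le> n \<and>
        length xs = r \<and> distinct xs \<and> set xs \<subseteq> ins \<and>
        length ys = r \<and> distinct ys \<and> set ys \<subseteq> outs \<longrightarrow>
        (\<exists>p :: nat \<Rightarrow> 'b awalk.
           (\<forall>i<r. pre_digraph.apath G (xs ! i) (p i) (ys ! i)) \<and>
           (\<forall>i<r. \<forall>j<r. i \<noteq> j \<longrightarrow>
              set (pre_digraph.awalk_verts G (xs ! i) (p i)) \<inter>
              set (pre_digraph.awalk_verts G (xs ! j) (p j)) = {})))"

definition ST_robust ::
    "nat \<Rightarrow> ('a, 'b) pre_digraph \<Rightarrow> 'a set \<Rightarrow> 'a set \<Rightarrow> nat \<Rightarrow> nat \<Rightarrow> bool" where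
  "ST_robust n G ins outs k1 k2 \<longleftrightarrow>
     io_dag n G ins outs \<and>
     (\<forall>D. D \<subseteq> verts G \<and> card D \<le> k1 \<longrightarrow>
        (\<exists>H. subgraph H (G \<restriction> (verts G - D)) \<and>
             card (ins \<inter> verts H) \<ge> k2 \<and>
             card (outs \<inter> verts H) \<ge> k2 \<and>
             (\<forall>s \<in> ins \<inter> verts H. \<forall>t \<in> outs \<inter> verts H. \<exists>p. pre_digraph.apath H s p t)))"

end

theory Submission
  imports Defs "HOL-Library.Disjoint_Sets"
begin

text \<open>
  Delete \<open>D\<close> and call a pair of an input \<open>s\<close> and an output \<open>t\<close> blocked if every path from \<open>s\<close> to
  \<open>t\<close> meets \<open>D\<close> or passes through a further input or output. Extend a matching of blocked pairs to
  a bijection between all inputs and all outputs: the vertex-disjoint paths of the connector then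
  use up all terminals, so each of them avoids the terminals of the others, and hence each path
  joining a blocked pair contains its own vertex of \<open>D\<close>. Thus a matching of blocked pairs has at
  most \<open>|D|\<close> edges. Removing the terminals of a maximal matching leaves no blocked pair, at the cost
  of at most \<open>|D|\<close> inputs and at most \<open>|D|\<close> outputs.

  Paths through further terminals count as blocked because inputs need not be sources and outputs
  need not be sinks: a removed terminal may lie inside a path.
\<close>

lemma card_le_card_if_disjoint_family_meets:
  assumes "finite D" and disj: "disjoint_family_on W A" and meets: "\<And>a. a \<in> A \<Longrightarrow> W a \<inter> D \<noteq> {}"
  shows "card A \<le> card D"
proof -
  obtain d where d: "\<And>a. a \<in> A \<Longrightarrow> d a \<in> W a \<inter> D"
    using bchoice[of A "\<lambda>a x. x \<in> W a \<inter> D"] meets by blast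
  have "inj_on d A"
  proof (rule inj_onI)
    fix a b assume "a \<in> A" "b \<in> A" "d a = d b"
    then show "a = b" using d[of a] d[of b] disjoint_family_onD[OF disj, of a b] by auto
  qed
  moreover have "d ` A \<subseteq> D" using d by blast
  ultimately show ?thesis using \<open>finite D\<close> by (rule card_inj_on_le)
qed

definition matching :: "('a \<times> 'b) set \<Rightarrow> bool" where
  "matching M \<longleftrightarrow> inj_on fst M \<and> inj_on snd M"

lemma matching_extends_to_bij_betw:
  assumes fin: "finite A" "finite B" and card: "card A = card B"
    and M: "matching M" "M \<subseteq> A \<times> B"
  obtains f where "bij_betw f A B" "\<And>a b. (a, b) \<in> M \<Longrightarrow> f a = b"
proof -
  define g where "g = snd \<circ> the_inv_into M fst"
  have g: "g a = b" if "(a, b) \<in> M" for a b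
    using M(1) that the_inv_into_f_f[of fst M "(a, b)"] by (simp add: g_def matching_def)
  have bij_g: "bij_betw g (fst ` M) (snd ` M)"
    using M(1) unfolding g_def matching_def
    by (intro bij_betw_trans[OF bij_betw_the_inv_into] inj_on_imp_bij_betw) auto
  have sub: "fst ` M \<subseteq> A" "snd ` M \<subseteq> B" using M(2) by auto
  then have "card (A - fst ` M) = card (B - snd ` M)"
    using fin card bij_betw_same_card[OF bij_g] by (simp add: card_Diff_subset finite_subset)
  then obtain h where bij_h: "bij_betw h (A - fst ` M) (B - snd ` M)"
    using fin finite_same_card_bij by blast
  define f where "f a = (if a \<in> fst ` M then g a else h a)" for a
  have "bij_betw f (fst ` M \<union> (A - fst ` M)) (snd ` M \<union> (B - snd ` M))"
    unfolding f_def using bij_g bij_h by (intro bij_betw_disjoint_Un) auto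
  then have "bij_betw f A B" using sub by (simp add: Un_absorb1)
  moreover have "f a = b" if "(a, b) \<in> M" for a b
    using g[OF that] that by (force simp: f_def)
  ultimately show thesis by (rule that)
qed

lemma disjoint_rectangle_if_matchings_le:
  assumes fin: "finite R" and le: "\<And>M. matching M \<Longrightarrow> M \<subseteq> R \<Longrightarrow> card M \<le> k"
  obtains A' B' where "A' \<subseteq> A" "B' \<subseteq> B" "card A - k \<le> card A'" "card B - k \<le> card B'"
    "R \<inter> A' \<times> B' = {}"
proof -
  have "finite {M. matching M \<and> M \<subseteq> R}"
    using fin by (auto intro: finite_subset[of _ "Pow R"])
  moreover have "{} \<in> {M. matching M \<and> M \<subseteq> R}" by (simp add: matching_def)
  ultimately obtain M where M: "matching M" "M \<subseteq> R"
    and maximal: "\<And>M'. matching M' \<Longrightarrow> M' \<subseteq> R \<Longrightarrow> M \<subseteq> M' \<Longrightarrow> M = M'"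
    using finite_has_maximal2[of "{M. matching M \<and> M \<subseteq> R}" "{}"] by auto
  have "finite M" using M(2) fin by (rule finite_subset)
  then have small: "card (fst ` M) \<le> k" "card (snd ` M) \<le> k"
    using le[OF M] card_image_le[of M] by (metis order_trans)+
  show thesis
  proof (rule that)
    show "card A - k \<le> card (A - fst ` M)" "card B - k \<le> card (B - snd ` M)"
      using small \<open>finite M\<close> diff_card_le_card_Diff[of "fst ` M" A]
        diff_card_le_card_Diff[of "snd ` M" B] by auto
    show "R \<inter> (A - fst ` M) \<times> (B - snd ` M) = {}"
    proof (rule equals0I)
      fix e assume e: "e \<in> R \<inter> (A - fst ` M) \<times> (B - snd ` M)"
      then have new: "fst e \<notin> fst ` M" "snd e \<notin> snd ` M"
        by (simp_all add: mem_Times_iff)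
      then have "matching (insert e M)"
        using M(1) unfolding matching_def inj_on_insert by blast
      then have "e \<in> M" using maximal[of "insert e M"] e M(2) by blast
      then show False using new by blast
    qed
  qed auto
qed

lemma (in wf_digraph) subgraph_induce_subgraph_mono:
  assumes "S \<subseteq> T"
  shows "subgraph (G \<restriction> S) (G \<restriction> T)"
  using assms by (auto simp: subgraph_def compatible_def wellformed_induce_subgraph)

definition (in pre_digraph) linkage :: "'a set \<Rightarrow> ('a \<Rightarrow> 'a) \<Rightarrow> ('a \<Rightarrow> 'b awalk) \<Rightarrow> bool" where
  "linkage A f p \<longleftrightarrow>
     (\<forall>s \<in> A. apath s (p s) (f s)) \<and> disjoint_family_on (\<lambda>s. set (awalk_verts s (p s))) A"

lemma (in wf_digraph) linkage_awalk_verts_subset: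
  assumes link: "linkage A f p" and s: "s \<in> A"
  shows "set (awalk_verts s (p s)) \<subseteq> verts G - (A - {s}) - (f ` A - {f s})"
proof -
  have walk: "awalk x (p x) (f x)" if "x \<in> A" for x
    using link that by (simp add: linkage_def apath_def)
  have "x \<in> set (awalk_verts x (p x))" "f x \<in> set (awalk_verts x (p x))" if "x \<in> A" for x
    using awalkE'[OF walk[OF that]] hd_in_set last_in_set awalk_verts_non_Nil by metis+
  moreover have "set (awalk_verts s (p s)) \<inter> set (awalk_verts x (p x)) = {}"
    if "x \<in> A" "x \<noteq> s" for x
    using link s that by (auto simp: linkage_def dest: disjoint_family_onD)
  moreover have "set (awalk_verts s (p s)) \<subseteq> verts G" using walk[OF s] by auto
  ultimately show ?thesis by blast
qed

lemma connectorD: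
  assumes "connector n G ins outs"
  shows "digraph G" "finite ins" "finite outs" "card ins = n" "card outs = n"
proof -
  have io: "io_dag n G ins outs" using assms by (simp add: connector_def)
  then show "digraph G" by (simp add: io_dag_def dag_def)
  then interpret digraph G .
  show "finite ins" "finite outs" "card ins = n" "card outs = n"
    using io finite_verts by (auto simp: io_dag_def intro: finite_subset)
qed

lemma connector_linkage:
  assumes conn: "connector n G ins outs" and f: "bij_betw f ins outs"
  obtains p where "pre_digraph.linkage G ins f p"
proof (cases "n = 0")
  case True
  then have "ins = {}" using connectorD[OF conn] by simp
  then show thesis using that by (simp add: pre_digraph.linkage_def disjoint_family_on_def)
next
  case False
  note terminals = connectorD[OF conn]
  obtain xs where xs: "distinct xs" "set xs = ins" "length xs = n"
    using finite_distinct_list[OF terminals(2)] terminals(4) distinct_card by metis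
  have ys: "distinct (map f xs)" "set (map f xs) = outs"
    using f xs by (auto simp: distinct_map bij_betw_def)
  let ?W = "\<lambda>i p. set (pre_digraph.awalk_verts G (xs ! i) p)"
  have "\<exists>q. (\<forall>i<n. pre_digraph.apath G (xs ! i) (q i) (f (xs ! i))) \<and>
      (\<forall>i<n. \<forall>j<n. i \<noteq> j \<longrightarrow> ?W i (q i) \<inter> ?W j (q j) = {})"
    using conn[unfolded connector_def, THEN conjunct2, rule_format, of n xs "map f xs"] False xs ys
    by auto
  then obtain q where path: "\<And>i. i < n \<Longrightarrow> pre_digraph.apath G (xs ! i) (q i) (f (xs ! i))"
    and disj: "\<And>i j. i < n \<Longrightarrow> j < n \<Longrightarrow> i \<noteq> j \<Longrightarrow> ?W i (q i) \<inter> ?W j (q j) = {}"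
    by blast
  have "\<forall>s \<in> ins. \<exists>i. i < n \<and> xs ! i = s" using xs by (auto simp: in_set_conv_nth)
  then obtain index where index: "\<And>s. s \<in> ins \<Longrightarrow> index s < n \<and> xs ! index s = s"
    by metis
  let ?p = "\<lambda>s. q (index s)"
  have "pre_digraph.apath G s (?p s) (f s)" if "s \<in> ins" for s
    using path[of "index s"] index[OF that] by simp
  moreover have "disjoint_family_on (\<lambda>s. set (pre_digraph.awalk_verts G s (?p s))) ins"
    unfolding disjoint_family_on_def
  proof (intro ballI impI)
    fix s s' assume s: "s \<in> ins" "s' \<in> ins" "s \<noteq> s'"
    then have "index s \<noteq> index s'" using index by metis
    then show "set (pre_digraph.awalk_verts G s (?p s)) \<inter>
        set (pre_digraph.awalk_verts G s' (?p s')) = {}"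
      using disj[of "index s" "index s'"] index[OF s(1)] index[OF s(2)] by simp
  qed
  ultimately have "pre_digraph.linkage G ins f ?p" by (simp add: pre_digraph.linkage_def)
  then show thesis by (rule that)
qed

definition restrict_terminals ::
    "('a, 'b) pre_digraph \<Rightarrow> 'a set \<Rightarrow> 'a set \<Rightarrow> 'a set \<Rightarrow> 'a set \<Rightarrow> 'a set \<Rightarrow> ('a, 'b) pre_digraph"
  where
  "restrict_terminals G ins outs D A B = G \<restriction> (verts G - D - (ins - A) - (outs - B))"

lemma (in wf_digraph) wf_digraph_restrict_terminals:
  "wf_digraph (restrict_terminals G ins outs D A B)"
  unfolding restrict_terminals_def by (rule wellformed_induce_subgraph)

definition blocked_pairs ::
    "('a, 'b) pre_digraph \<Rightarrow> 'a set \<Rightarrow> 'a set \<Rightarrow> 'a set \<Rightarrow> ('a \<times> 'a) set" where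
  "blocked_pairs G ins outs D =
     {(s, t) \<in> ins \<times> outs. \<not> s \<rightarrow>\<^sup>*\<^bsub>restrict_terminals G ins outs D {s} {t}\<^esub> t}"

lemma (in wf_digraph) linkage_meets_if_blocked:
  assumes link: "linkage ins f p" and f: "f ` ins = outs" and s: "s \<in> ins"
    and blocked: "(s, f s) \<in> blocked_pairs G ins outs D"
  shows "set (awalk_verts s (p s)) \<inter> D \<noteq> {}"
proof
  assume "set (awalk_verts s (p s)) \<inter> D = {}"
  then have "set (awalk_verts s (p s)) \<subseteq> verts G - D - (ins - {s}) - (outs - {f s})"
    using linkage_awalk_verts_subset[OF link s] f by blast
  moreover have "awalk s (p s) (f s)" using link s by (simp add: linkage_def apath_def)
  ultimately have "s \<rightarrow>\<^sup>*\<^bsub>restrict_terminals G ins outs D {s} {f s}\<^esub> f s"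
    unfolding restrict_terminals_def
    by (intro wf_digraph.reachable_awalkI[OF wellformed_induce_subgraph awalk_induce])
  then show False using blocked by (simp add: blocked_pairs_def)
qed

lemma card_blocked_matching_le:
  assumes conn: "connector n G ins outs" and D: "finite D"
    and M: "matching M" "M \<subseteq> blocked_pairs G ins outs D"
  shows "card M \<le> card D"
proof -
  note terminals = connectorD[OF conn]
  interpret digraph G by (rule terminals)
  have M_sub: "M \<subseteq> ins \<times> outs" using M(2) by (auto simp: blocked_pairs_def)
  then obtain f where f: "bij_betw f ins outs" and f_M: "\<And>s t. (s, t) \<in> M \<Longrightarrow> f s = t"
    using matching_extends_to_bij_betw[OF terminals(2,3) _ M(1)] terminals(4,5) by auto
  obtain p where link: "linkage ins f p" using connector_linkage[OF conn f] .
  have "card M = card (fst ` M)" using M(1) by (simp add: matching_def card_image)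
  also have "\<dots> \<le> card D"
  proof (rule card_le_card_if_disjoint_family_meets[OF D])
    have "fst ` M \<subseteq> ins" using M_sub by auto
    then show "disjoint_family_on (\<lambda>s. set (awalk_verts s (p s))) (fst ` M)"
      using link disjoint_family_on_mono by (auto simp: linkage_def)
    fix s assume "s \<in> fst ` M"
    then have "(s, f s) \<in> M" using f_M by force
    then show "set (awalk_verts s (p s)) \<inter> D \<noteq> {}"
      using M(2) M_sub f
      by (intro linkage_meets_if_blocked[OF link]) (auto simp: bij_betw_def)
  qed
  finally show ?thesis .
qed

lemma connector_unblocked_terminals:
  assumes conn: "connector n G ins outs" and D: "finite D"
  obtains A B where "A \<subseteq> ins" "B \<subseteq> outs" "n - card D \<le> card A" "n - card D \<le> card B"
    "blocked_pairs G ins outs D \<inter> A \<times> B = {}"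
proof -
  note terminals = connectorD[OF conn]
  have "finite (blocked_pairs G ins outs D)"
    using terminals by (auto simp: blocked_pairs_def intro: finite_subset[of _ "ins \<times> outs"])
  then show thesis
    using card_blocked_matching_le[OF conn D] that terminals
    by (elim disjoint_rectangle_if_matchings_le[of _ "card D" ins outs]) auto
qed

lemma (in wf_digraph) restrict_terminals_reachable:
  assumes "A \<subseteq> ins" "B \<subseteq> outs" "blocked_pairs G ins outs D \<inter> A \<times> B = {}"
    and s: "s \<in> A" and t: "t \<in> B"
  shows "s \<rightarrow>\<^sup>*\<^bsub>restrict_terminals G ins outs D A B\<^esub> t"
proof (rule pre_digraph.reachable_mono)
  show "s \<rightarrow>\<^sup>*\<^bsub>restrict_terminals G ins outs D {s} {t}\<^esub> t"
    using assms by (auto simp: blocked_pairs_def)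
  show "subgraph (restrict_terminals G ins outs D {s} {t}) (restrict_terminals G ins outs D A B)"
    unfolding restrict_terminals_def using s t by (intro subgraph_induce_subgraph_mono) auto
qed

lemma (in wf_digraph) restrict_terminals_apath:
  assumes "A \<subseteq> ins" "B \<subseteq> outs" "blocked_pairs G ins outs D \<inter> A \<times> B = {}" "s \<in> A" "t \<in> B"
  shows "\<exists>p. pre_digraph.apath (restrict_terminals G ins outs D A B) s p t"
proof -
  interpret H: wf_digraph "restrict_terminals G ins outs D A B"
    by (rule wf_digraph_restrict_terminals)
  show ?thesis using restrict_terminals_reachable[OF assms] by (simp add: H.reachable_apath)
qed

lemma (in wf_digraph) card_restrict_terminals:
  assumes sub: "A \<subseteq> ins" "B \<subseteq> outs" and unblocked: "blocked_pairs G ins outs D \<inter> A \<times> B = {}"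
    and card: "m \<le> card A" "m \<le> card B"
  shows "m \<le> card (ins \<inter> verts (restrict_terminals G ins outs D A B))"
    and "m \<le> card (outs \<inter> verts (restrict_terminals G ins outs D A B))"
proof -
  let ?H = "restrict_terminals G ins outs D A B"
  interpret H: wf_digraph ?H by (rule wf_digraph_restrict_terminals)
  have "m \<le> card (ins \<inter> verts ?H) \<and> m \<le> card (outs \<inter> verts ?H)"
  proof (cases "A = {} \<or> B = {}")
    case True
    then show ?thesis using card by auto
  next
    case False
    have "s \<in> verts ?H \<and> t \<in> verts ?H" if "s \<in> A" "t \<in> B" for s t
      using restrict_terminals_reachable[OF sub unblocked that] H.reachable_in_verts by blast
    with False have "A \<subseteq> verts ?H" "B \<subseteq> verts ?H" by blast+
    then have "ins \<inter> verts ?H = A" "outs \<inter> verts ?H = B"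
      using sub by (auto simp: restrict_terminals_def)
    then show ?thesis using card by simp
  qed
  then show "m \<le> card (ins \<inter> verts ?H)" "m \<le> card (outs \<inter> verts ?H)" by auto
qed

theorem theorem3:
  fixes G :: "('a, 'b) pre_digraph" and ins outs :: "'a set" and n :: nat
  assumes "connector n G ins outs"
  shows "\<forall>k. 1 \<le> k \<and> k \<le> n \<longrightarrow> ST_robust n G ins outs k (n - k)"
  unfolding ST_robust_def
proof (intro allI impI conjI)
  show "io_dag n G ins outs" using assms by (simp add: connector_def)
  interpret digraph G by (rule connectorD(1)[OF assms])
  fix k D assume D: "D \<subseteq> verts G \<and> card D \<le> k"
  then have "finite D" using finite_verts finite_subset by blast
  then obtain A B where sub: "A \<subseteq> ins" "B \<subseteq> outs"
    and card: "n - card D \<le> card A" "n - card D \<le> card B"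
    and unblocked: "blocked_pairs G ins outs D \<inter> A \<times> B = {}"
    by (rule connector_unblocked_terminals[OF assms])
  have "n - k \<le> card A" "n - k \<le> card B" using card D by linarith+
  note large = card_restrict_terminals[OF sub unblocked this]
  let ?H = "restrict_terminals G ins outs D A B"
  have "subgraph ?H (G \<restriction> (verts G - D))"
    unfolding restrict_terminals_def by (rule subgraph_induce_subgraph_mono) auto
  moreover have "\<forall>s \<in> ins \<inter> verts ?H. \<forall>t \<in> outs \<inter> verts ?H. \<exists>p. pre_digraph.apath ?H s p t"
    using restrict_terminals_apath[OF sub unblocked] by (auto simp: restrict_terminals_def)
  ultimately show "\<exists>H. subgraph H (G \<restriction> (verts G - D)) \<and> n - k \<le> card (ins \<inter> verts H) \<and>
      n - k \<le> card (outs \<inter> verts H) \<and>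
      (\<forall>s \<in> ins \<inter> verts H. \<forall>t \<in> outs \<inter> verts H. \<exists>p. pre_digraph.apath H s p t)"
    using large by blast
qed

end
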